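(* Let $\lambda$ and $\mu$ be partitions of $n$ and let $\sigma$ be a permutation chosen uniformly at random from the double coset in $S_\lambda\backslash S_n/S_\mu$ indexed by $T$. Let $W:=\mathrm{fp}(\sigma)$ be the number of fixed points of $\sigma$. Let $\mu_n:=E(W)$ and $\sigma_n^2:=\mathrm{Var}(W)$. Then $$P\left(\frac{W-\mu_n}{\sigma_n}\leq -t\right)\leq\exp\left(-\frac{\sigma_n^2t^2}{4\mu_n}\right),$$ $$P\left(\frac{W-\mu_n}{\sigma_n}\geq t\right)\leq\exp\left(-\frac{\sigma_n^2t^2}{4\mu_n+2\sigma_nt}\right),$$ for all $t>0$.
   Context: A partition $\lambda=(\lambda_1,\ldots,\lambda_I)$ of $n$ satisfies $\lambda_1\ge\dots\ge\lambda_I>0$ and $\lambda_1+\dots+\lambda_I=n$. Its $\lambda_i$-block is $L_i=\{\lambda_1+\dots+\lambda_{i-1}+1,\ldots,\lambda_1+\dots+\lambda_i\}$; the $\mu_j$-block $M_j$ is defined analogously for $\mu=(\mu_1,\ldots,\mu_J)$. The parabolic subgroup $S_\lambda\cong S_{\lambda_1}\times\dots\times S_{\lambda_I}$ is the set of permutations in $S_n$ preserving each block $L_i$ (similarly $S_\mu$). For $\sigma\in S_n$, the contingency table $T(\sigma)$ is the $I\times J$ table whose entry $T_{ij}$ is the number of elements of $M_j$ occurring in the positions of $\sigma$ given by $L_i$, i.e. $T_{ij}=|\{p\in L_i:\sigma(p)\in M_j\}|$; it has row sums $\lambda$ and column sums $\mu$. The parabolic double cosets in $S_\lambda\backslash S_n/S_\mu$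 are in bijection with the nonnegative integer tables with row sums $\lambda$ and column sums $\mu$; the double coset indexed by $T$ is the set of all $\sigma\in S_n$ with $T(\sigma)=T$. A fixed point of $\sigma$ is an $i\in[n]$ with $\sigma(i)=i$. *)

theory Defs
  imports "HOL-Probability.Probability" "HOL-Combinatorics.Permutations"
begin

text \<open>
  Partitions are lists of parts and are indexed from 0, so \<open>block \<lambda> i\<close> is the block
  $L_{i+1}$. Elements of $S_n$ are functions permuting \<open>{1..n}\<close> (and fixing every other
  number).
\<close>

definition is_partition :: "nat \<Rightarrow> nat list \<Rightarrow> bool" where
  "is_partition n xs \<longleftrightarrow> sorted_wrt (\<ge>) xs \<and> (\<forall>x\<in>set xs. x > 0) \<and> sum_list xs = n"

definition block :: "nat list \<Rightarrow> nat \<Rightarrow> nat set" where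
  "block xs i = {sum_list (take i xs) + 1 .. sum_list (take (Suc i) xs)}"

definition parabolic_subgroup :: "nat \<Rightarrow> nat list \<Rightarrow> (nat \<Rightarrow> nat) set" where
  "parabolic_subgroup n xs =
     {\<pi>. \<pi> permutes {1..n} \<and> (\<forall>i<length xs. \<pi> ` block xs i = block xs i)}"

text \<open>
  With \<open>\<sigma>\<close> read as the word \<open>\<sigma>(1), \<dots>, \<sigma>(n)\<close>, the subgroup $S_\lambda$ acts on positions and
  $S_\mu$ on values. The product \<open>\<pi> \<sigma> \<tau>\<close> of $S_\lambda \sigma S_\mu$, evaluated from left to
  right, is therefore the function \<open>\<tau> \<circ> \<sigma> \<circ> \<pi>\<close>.
\<close>

definition parabolic_double_coset ::
    "nat \<Rightarrow> nat list \<Rightarrow> nat list \<Rightarrow> (nat \<Rightarrow> nat) \<Rightarrow> (nat \<Rightarrow> nat) set" where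
  "parabolic_double_coset n lam mu \<sigma> =
     {\<tau> \<circ> \<sigma> \<circ> \<pi> | \<pi> \<tau>. \<pi> \<in> parabolic_subgroup n lam \<and> \<tau> \<in> parabolic_subgroup n mu}"

definition table_of :: "nat list \<Rightarrow> nat list \<Rightarrow> (nat \<Rightarrow> nat) \<Rightarrow> nat \<Rightarrow> nat \<Rightarrow> nat" where
  "table_of lam mu \<sigma> i j = card {p \<in> block lam i. \<sigma> p \<in> block mu j}"

text \<open>
  Only the entries \<open>T i j\<close> with \<open>i < length lam\<close> and \<open>j < length mu\<close> belong to a table.
\<close>

definition contingency_table :: "nat list \<Rightarrow> nat list \<Rightarrow> (nat \<Rightarrow> nat \<Rightarrow> nat) \<Rightarrow> bool" where
  "contingency_table lam mu T \<longleftrightarrow>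
     (\<forall>i<length lam. (\<Sum>j<length mu. T i j) = lam ! i) \<and>
     (\<forall>j<length mu. (\<Sum>i<length lam. T i j) = mu ! j)"

definition double_coset_of_table ::
    "nat \<Rightarrow> nat list \<Rightarrow> nat list \<Rightarrow> (nat \<Rightarrow> nat \<Rightarrow> nat) \<Rightarrow> (nat \<Rightarrow> nat) set" where
  "double_coset_of_table n lam mu T =
     {\<sigma>. \<sigma> permutes {1..n} \<and>
        (\<forall>i<length lam. \<forall>j<length mu. table_of lam mu \<sigma> i j = T i j)}"

definition fp :: "nat \<Rightarrow> (nat \<Rightarrow> nat) \<Rightarrow> nat" where
  "fp n \<sigma> = card {i \<in> {1..n}. \<sigma> i = i}"

lemma block_cover:
  assumes "1 \<le> p" "p \<le> sum_list xs"
  shows "\<exists>i<length xs. p \<in> block xs i"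
proof -
  define k where "k = (LEAST k. p \<le> sum_list (take k xs))"
  have k: "p \<le> sum_list (take k xs)"
    unfolding k_def by (rule LeastI[of _ "length xs"]) (use assms in simp)
  have kle: "k \<le> length xs"
    unfolding k_def by (rule Least_le) (use assms in simp)
  have "k \<noteq> 0" using k assms by (intro notI) simp
  then obtain i where i: "k = Suc i" using not0_implies_Suc by blast
  have "\<not> p \<le> sum_list (take i xs)"
    using not_less_Least[of i "\<lambda>k. p \<le> sum_list (take k xs)"] i unfolding k_def by simp
  then show ?thesis using i k kle unfolding block_def by (intro exI[of _ i]) auto
qed

lemma sum_list_take_mono:
  fixes xs :: "nat list"
  assumes "i \<le> j"
  shows "sum_list (take i xs) \<le> sum_list (take j xs)"
proof -
  have "take j xs = take i xs @ take (j - i) (drop i xs)"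
    using assms by (metis le_add_diff_inverse take_add)
  then show ?thesis by simp
qed

lemma block_unique:
  assumes "p \<in> block xs i" "p \<in> block xs j"
  shows "i = j"
proof (rule ccontr)
  assume "i \<noteq> j"
  then consider "Suc i \<le> j" | "Suc j \<le> i" by linarith
  then show False
    using assms sum_list_take_mono[of "Suc i" j xs] sum_list_take_mono[of "Suc j" i xs]
    by cases (auto simp: block_def)
qed

lemma block_subset: "block xs i \<subseteq> {1..sum_list xs}"
  using sum_list_take_mono[of "Suc i" "max (Suc i) (length xs)" xs]
  by (auto simp: block_def)

lemma finite_block: "finite (block xs i)"
  by (simp add: block_def)

lemma mem_parabolic_subgroupI:
  assumes perm: "\<pi> permutes {1..n}"
    and pres: "\<And>i p. i < length xs \<Longrightarrow> p \<in> block xs i \<Longrightarrow> \<pi> p \<in> block xs i"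
  shows "\<pi> \<in> parabolic_subgroup n xs"
proof -
  have "\<pi> ` block xs i = block xs i" if "i < length xs" for i
    using pres[OF that] inj_on_subset[OF permutes_inj[OF perm], of "block xs i"]
    by (intro endo_inj_surj[OF finite_block]) auto
  then show ?thesis using perm by (simp add: parabolic_subgroup_def)
qed

text \<open>
  A nonempty \<open>double_coset_of_table n lam mu T\<close> is the double coset $S_\lambda \sigma S_\mu$ of
  any of its elements \<open>\<sigma>\<close>.
\<close>

lemma double_coset_of_table_eq:
  assumes lam: "is_partition n lam" and mu: "is_partition n mu"
    and \<sigma>: "\<sigma> \<in> double_coset_of_table n lam mu T"
  shows "double_coset_of_table n lam mu T = parabolic_double_coset n lam mu \<sigma>"
proof (intro equalityI subsetI)
  have slam: "sum_list lam = n" and smu: "sum_list mu = n"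
    using lam mu by (auto simp: is_partition_def)
  have sp: "\<sigma> permutes {1..n}"
    and sT: "\<And>i j. i < length lam \<Longrightarrow> j < length mu \<Longrightarrow> table_of lam mu \<sigma> i j = T i j"
    using \<sigma> by (auto simp: double_coset_of_table_def)
  {
    fix \<rho> assume "\<rho> \<in> parabolic_double_coset n lam mu \<sigma>"
    then obtain \<pi> \<tau> where r: "\<rho> = \<tau> \<circ> \<sigma> \<circ> \<pi>"
      and pi: "\<pi> \<in> parabolic_subgroup n lam" and tau: "\<tau> \<in> parabolic_subgroup n mu"
      by (auto simp: parabolic_double_coset_def)
    have pp: "\<pi> permutes {1..n}" and tp: "\<tau> permutes {1..n}"
      using pi tau by (auto simp: parabolic_subgroup_def)
    have rp: "\<rho> permutes {1..n}"
      unfolding r by (intro permutes_compose pp sp tp)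
    have "table_of lam mu \<rho> i j = T i j" if ij: "i < length lam" "j < length mu" for i j
    proof -
      have im: "\<pi> ` block lam i = block lam i" "\<tau> ` block mu j = block mu j"
        using pi tau ij by (auto simp: parabolic_subgroup_def)
      have t: "\<tau> v \<in> block mu j \<longleftrightarrow> v \<in> block mu j" for v
        using im(2) inj_image_mem_iff[OF permutes_inj[OF tp], of v "block mu j"] by simp
      have p: "\<pi> v \<in> block lam i \<longleftrightarrow> v \<in> block lam i" for v
        using im(1) inj_image_mem_iff[OF permutes_inj[OF pp], of v "block lam i"] by simp
      have "\<pi> ` {p \<in> block lam i. \<rho> p \<in> block mu j} = {p \<in> block lam i. \<sigma> p \<in> block mu j}"
      proof (intro equalityI subsetI)
        fix q assume q: "q \<in> {p \<in> block lam i. \<sigma> p \<in> block mu j}"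
        obtain p' where p': "q = \<pi> p'" using permutes_surj[OF pp] by (meson surjD)
        then show "q \<in> \<pi> ` {p \<in> block lam i. \<rho> p \<in> block mu j}"
          using q p t by (auto simp: r)
      qed (auto simp: r t p)
      then have "table_of lam mu \<rho> i j = table_of lam mu \<sigma> i j"
        unfolding table_of_def
        using card_image[OF inj_on_subset[OF permutes_inj[OF pp] subset_UNIV]] by metis
      then show ?thesis using sT ij by simp
    qed
    then show "\<rho> \<in> double_coset_of_table n lam mu T"
      using rp by (simp add: double_coset_of_table_def)
  }
  {
    fix \<rho> assume r: "\<rho> \<in> double_coset_of_table n lam mu T"
    have rp: "\<rho> permutes {1..n}"
      and rT: "\<And>i j. i < length lam \<Longrightarrow> j < length mu \<Longrightarrow> table_of lam mu \<rho> i j = T i j"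
      using r by (auto simp: double_coset_of_table_def)
    define A where "A \<theta> i j = {p \<in> block lam i. \<theta> p \<in> block mu j}"
      for \<theta> :: "nat \<Rightarrow> nat" and i j
    have finA: "finite (A \<theta> i j)" for \<theta> i j
      by (simp add: A_def finite_block)
    have "\<exists>g. bij_betw g (A \<rho> i j) (A \<sigma> i j)" if "i < length lam" "j < length mu" for i j
      using rT[OF that] sT[OF that] finA
      by (intro finite_same_card_bij) (auto simp: A_def table_of_def)
    then obtain g where g: "\<And>i j. i < length lam \<Longrightarrow> j < length mu \<Longrightarrow>
        bij_betw (g i j) (A \<rho> i j) (A \<sigma> i j)"
      by metis
    have "\<exists>i. i < length lam \<and> p \<in> block lam i" if "p \<in> {1..n}" for p
      using block_cover[of p lam] that slam by auto
    then obtain row where row: "\<And>p. p \<in> {1..n} \<Longrightarrow> row p < length lam \<and> p \<in> block lam (row p)"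
      by metis
    have "\<exists>j. j < length mu \<and> v \<in> block mu j" if "v \<in> {1..n}" for v
      using block_cover[of v mu] that smu by auto
    then obtain col where col: "\<And>v. v \<in> {1..n} \<Longrightarrow> col v < length mu \<and> v \<in> block mu (col v)"
      by metis
    define \<pi> where "\<pi> p = (if p \<in> {1..n} then g (row p) (col (\<rho> p)) p else p)" for p
    have rin: "\<rho> p \<in> {1..n}" if "p \<in> {1..n}" for p
      using permutes_in_image[OF rp] that by blast
    have piA: "\<pi> p \<in> A \<sigma> (row p) (col (\<rho> p))" and inA: "p \<in> A \<rho> (row p) (col (\<rho> p))"
      if p: "p \<in> {1..n}" for p
    proof -
      show 1: "p \<in> A \<rho> (row p) (col (\<rho> p))"
        using row[OF p] col[OF rin[OF p]] by (auto simp: A_def)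
      show "\<pi> p \<in> A \<sigma> (row p) (col (\<rho> p))"
        using bij_betwE[OF g] row[OF p] col[OF rin[OF p]] 1 p by (auto simp: \<pi>_def)
    qed
    have inj: "inj_on \<pi> {1..n}"
    proof (rule inj_onI)
      fix p q assume p: "p \<in> {1..n}" and q: "q \<in> {1..n}" and e: "\<pi> p = \<pi> q"
      have rr: "row p = row q"
        using piA[OF p] piA[OF q] e block_unique by (auto simp: A_def)
      have cc: "col (\<rho> p) = col (\<rho> q)"
        using piA[OF p] piA[OF q] e block_unique by (auto simp: A_def)
      have "inj_on (g (row q) (col (\<rho> q))) (A \<rho> (row q) (col (\<rho> q)))"
        using g row[OF q] col[OF rin[OF q]] by (auto simp: bij_betw_def)
      moreover have "g (row q) (col (\<rho> q)) p = g (row q) (col (\<rho> q)) q"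
        using e p q rr cc by (simp add: \<pi>_def)
      ultimately show "p = q"
        using inA[OF p] inA[OF q] rr cc by (auto dest: inj_onD)
    qed
    have "\<pi> p \<in> {1..n}" if "p \<in> {1..n}" for p
      using piA[OF that] block_subset[of lam "row p"] slam unfolding A_def by blast
    then have "\<pi> ` {1..n} \<subseteq> {1..n}" by blast
    then have "bij_betw \<pi> {1..n} {1..n}"
      using inj endo_inj_surj[of "{1..n}" \<pi>] unfolding bij_betw_def by blast
    then have pp: "\<pi> permutes {1..n}"
      by (rule bij_imp_permutes) (auto simp: \<pi>_def)
    have p1: "\<pi> \<in> parabolic_subgroup n lam"
    proof (rule mem_parabolic_subgroupI[OF pp])
      fix i p assume p: "p \<in> block lam i"
      then have "p \<in> {1..n}" using block_subset slam by blast
      then show "\<pi> p \<in> block lam i"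
        using piA[of p] row[of p] block_unique[OF p] by (auto simp: A_def)
    qed
    define \<tau> where "\<tau> = \<rho> \<circ> inv (\<sigma> \<circ> \<pi>)"
    have spp: "(\<sigma> \<circ> \<pi>) permutes {1..n}" by (intro permutes_compose pp sp)
    have tp: "\<tau> permutes {1..n}"
      unfolding \<tau>_def by (intro permutes_compose permutes_inv spp rp)
    have tsp: "\<tau> (\<sigma> (\<pi> p)) = \<rho> p" for p
      using permutes_inverses(2)[OF spp, of p] by (simp add: \<tau>_def)
    have t1: "\<tau> \<in> parabolic_subgroup n mu"
    proof (rule mem_parabolic_subgroupI[OF tp])
      fix j v assume v: "v \<in> block mu j"
      then have vn: "v \<in> {1..n}" using block_subset smu by blast
      obtain p where p: "v = \<sigma> (\<pi> p)"
        using permutes_surj[OF spp] by (metis comp_apply surjD)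
      then have pn: "p \<in> {1..n}"
        using vn permutes_in_image[OF spp, of p] by simp
      have "col (\<rho> p) = j"
        using piA[OF pn] v p block_unique by (auto simp: A_def)
      then show "\<tau> v \<in> block mu j"
        using p tsp inA[OF pn] by (auto simp: A_def)
    qed
    have "\<rho> = \<tau> \<circ> \<sigma> \<circ> \<pi>" using tsp by auto
    then show "\<rho> \<in> parabolic_double_coset n lam mu \<sigma>"
      using p1 t1 by (auto simp: parabolic_double_coset_def)
  }
qed

end

theory Submission
  imports Defs
begin

text \<open>
  The proof bounds exponential moments with a size-bias coupling. Choose a random \<open>\<sigma>\<close> in the double
  coset and a point \<open>p\<close>, and force \<open>p\<close> to be fixed without changing the table: choose a position
  \<open>a\<close> in the row block of \<open>p\<close> whose value \<open>v = \<sigma> a\<close> lies in the column block of \<open>p\<close>, and replace \<open>\<sigma>\<close> by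
  \<open>transpose p v \<circ> \<sigma> \<circ> transpose p a\<close>. Weighting \<open>(p, a)\<close> by the reciprocal of the product of the two
  block sizes, the resulting permutation has the law of \<open>\<sigma>\<close> biased by its number \<open>W\<close> of fixed points
  (lemma \<open>size_bias_identity\<close>). So \<open>E[W exp (\<theta> W)]\<close> is controlled by how many fixed points the move
  gains.

  If a move gained at most two fixed points, this would give the stated bounds. A move can gain
  three, but only when it dissolves a 3-cycle \<open>p \<mapsto> a \<mapsto> b \<mapsto> p\<close> of \<open>\<sigma>\<close> (lemma \<open>gain_gt_2D\<close>). In that
  case the choices \<open>(a, p)\<close> and \<open>(b, b)\<close> gain at most one, and one of them is at least as heavy as
  \<open>(p, a)\<close>. Otherwise \<open>a\<close> would lie in a larger column block than \<open>p\<close>, and \<open>b\<close> in a larger row block;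
  as blocks are consecutive intervals of decreasing size, that would mean both \<open>a < b\<close> and \<open>b < a\<close>
  (lemma \<open>noncrossing_blocks\<close>). So a gain of three is paired with a gain of at most one, and on
  average the gain is at most two (lemma \<open>sum_gain_le\<close>).

  Writing \<open>m\<close> for the mean, this yields \<open>E[W exp (\<theta> W)] \<le> m / (1 - \<theta>)\<^sup>2 * E[exp (\<theta> W)]\<close> for
  \<open>0 \<le> \<theta> < 1\<close>, and \<open>E[W exp (- \<theta> W)] \<ge> m * (1 - 2 * \<theta>) * E[exp (- \<theta> W)]\<close> for \<open>\<theta> \<ge> 0\<close>. Integrating these
  differential inequalities and applying the Chernoff bound gives the two tails. The double coset is
  nonempty because every contingency table is the table of a permutation.
\<close>

section \<open>The size-bias coupling on a double coset\<close>

hide_const (open) Finite_Cartesian_Product.transpose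

text \<open>
  A table coset is a double coset seen without coordinates. A point \<open>p\<close> has a row label \<open>r p\<close>, used
  when it is a position, and a column label \<open>c p\<close>, used when it is a value. Only the label fibres
  matter for the coupling; the order of the points enters later, through the sizes of the fibres.
\<close>

locale table_coset =
  fixes S :: "'a set" and r c :: "'a \<Rightarrow> nat" and T :: "nat \<Rightarrow> nat \<Rightarrow> nat"
  assumes finite_S: "finite S"
begin


definition coset :: "('a \<Rightarrow> 'a) set" where
  "coset = {\<sigma>. \<sigma> permutes S \<and> (\<forall>i j. card {x \<in> S. r x = i \<and> c (\<sigma> x) = j} = T i j)}"

definition fixes_of :: "('a \<Rightarrow> 'a) \<Rightarrow> nat" where
  "fixes_of \<sigma> = card {x \<in> S. \<sigma> x = x}"

definition row_size :: "'a \<Rightarrow> nat" where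
  "row_size p = card {q \<in> S. r q = r p}"

definition col_size :: "'a \<Rightarrow> nat" where
  "col_size p = card {q \<in> S. c q = c p}"

text \<open>
  For a cell with entry \<open>T\<close>, the probability that a point \<open>p\<close> of that row and column is fixed is
  \<open>T * weight p\<close>. Summing over \<open>p\<close> gives the mean number of fixed points, \<open>mean_fixes\<close> below.
\<close>

definition weight :: "'a \<Rightarrow> real" where
  "weight p = 1 / (real (row_size p) * real (col_size p))"

text \<open>
  A choice \<open>(p, a)\<close> consists of a point \<open>p\<close> to be fixed and a position \<open>a\<close> in the row of \<open>p\<close> whose
  value lies in the column of \<open>p\<close>. The move exchanges the positions \<open>p\<close> and \<open>a\<close> and then the
  values \<open>\<sigma> a\<close> and \<open>p\<close>, so that position \<open>p\<close> ends with value \<open>p\<close>. As both transpositions stay inside a row and a column, the table does not change.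
\<close>

definition choices :: "('a \<Rightarrow> 'a) \<Rightarrow> ('a \<times> 'a) set" where
  "choices \<sigma> = {(p, a). p \<in> S \<and> a \<in> S \<and> r a = r p \<and> c (\<sigma> a) = c p}"

definition move :: "('a \<Rightarrow> 'a) \<Rightarrow> 'a \<times> 'a \<Rightarrow> 'a \<Rightarrow> 'a" where
  "move \<sigma> = (\<lambda>(p, a). transpose p (\<sigma> a) \<circ> \<sigma> \<circ> transpose p a)"

definition mean_fixes :: real where
  "mean_fixes = (\<Sum>p\<in>S. real (T (r p) (c p)) * weight p)"

definition gain :: "('a \<Rightarrow> 'a) \<Rightarrow> 'a \<times> 'a \<Rightarrow> real" where
  "gain \<sigma> x = real (fixes_of (move \<sigma> x)) - real (fixes_of \<sigma>)"

lemma finite_coset: "finite coset"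
  by (rule finite_subset[OF _ finite_permutations[OF finite_S]]) (auto simp: coset_def)

lemma finite_choices: "finite (choices \<sigma>)"
  by (rule finite_subset[of _ "S \<times> S"]) (auto simp: choices_def finite_S)

lemma row_size_pos: "p \<in> S \<Longrightarrow> row_size p > 0"
  by (auto simp: row_size_def card_gt_0_iff finite_S)

lemma col_size_pos: "p \<in> S \<Longrightarrow> col_size p > 0"
  by (auto simp: col_size_def card_gt_0_iff finite_S)

lemma weight_nonneg: "weight p \<ge> 0"
  by (simp add: weight_def)

lemma coset_permutes: "\<sigma> \<in> coset \<Longrightarrow> \<sigma> permutes S"
  by (simp add: coset_def)

lemma transpose_preserves_label:
  assumes "f p = f a"
  shows "f (transpose p a x) = f x"
  using assms by (cases "x = p"; cases "x = a") auto

lemma coset_closed: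
  assumes "\<sigma> \<in> coset" "p \<in> S" "a \<in> S" "v \<in> S" "r a = r p" "c v = c p"
  shows "transpose p v \<circ> \<sigma> \<circ> transpose p a \<in> coset"
proof -
  let ?\<rho> = "transpose p v \<circ> \<sigma> \<circ> transpose p a"
  have "?\<rho> permutes S"
    using assms by (intro permutes_compose permutes_swap_id coset_permutes)
  moreover have "card {x \<in> S. r x = i \<and> c (?\<rho> x) = j} = T i j" for i j
  proof -
    have tS: "transpose p a x \<in> S \<longleftrightarrow> x \<in> S" for x
      using assms permutes_in_image[OF permutes_swap_id[of p S a]] by blast
    have rr: "r (transpose p a x) = r x" and cc: "c (transpose p v x) = c x" for x
      using assms by (simp_all only: transpose_preserves_label)
    have "bij_betw (transpose p a) {x \<in> S. r x = i \<and> c (?\<rho> x) = j}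
            {x \<in> S. r x = i \<and> c (\<sigma> x) = j}"
      by (rule bij_betw_byWitness[where f' = "transpose p a"])
        (use tS rr cc in auto)
    then show ?thesis
      using assms(1) bij_betw_same_card by (fastforce simp: coset_def)
  qed
  ultimately show ?thesis by (simp add: coset_def)
qed

lemma move_in_coset:
  assumes "\<sigma> \<in> coset" "x \<in> choices \<sigma>"
  shows "move \<sigma> x \<in> coset"
  using assms coset_closed[OF assms(1)] permutes_in_image[OF coset_permutes[OF assms(1)]]
  by (auto simp: choices_def move_def)

lemma sum_weight_choices:
  assumes "\<sigma> \<in> coset"
  shows "(\<Sum>x\<in>choices \<sigma>. weight (fst x)) = mean_fixes"
proof -
  have "choices \<sigma> = (SIGMA p:S. {a \<in> S. r a = r p \<and> c (\<sigma> a) = c p})"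
    by (auto simp: choices_def)
  then have "(\<Sum>x\<in>choices \<sigma>. weight (fst x)) =
      (\<Sum>p\<in>S. \<Sum>a\<in>{a \<in> S. r a = r p \<and> c (\<sigma> a) = c p}. weight p)"
    by (subst sum.Sigma) (auto simp: finite_S split_def)
  also have "\<dots> = mean_fixes"
    using assms by (simp add: mean_fixes_def coset_def)
  finally show ?thesis .
qed

text \<open>
  The move realises the size-biased distribution: summing a function of the moved permutation over
  all weighted choices is the same as weighting it with the number of fixed points. The reason is
  that a move is undone by knowing \<open>p\<close>, \<open>a\<close> and the value \<open>v\<close> at \<open>a\<close>. Any \<open>\<rho>\<close> fixing \<open>p\<close> therefore
  arises once from each \<open>a\<close> in the row and each \<open>v\<close> in the column of \<open>p\<close>, and the weight is the
  reciprocal of the number of such pairs.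
\<close>

lemma size_bias_identity:
  fixes h :: "('a \<Rightarrow> 'a) \<Rightarrow> real"
  shows "(\<Sum>\<sigma>\<in>coset. \<Sum>x\<in>choices \<sigma>. weight (fst x) * h (move \<sigma> x)) =
    (\<Sum>\<sigma>\<in>coset. real (fixes_of \<sigma>) * h \<sigma>)"
proof -
  define fibre where "fibre \<sigma> = (SIGMA p:{p \<in> S. \<sigma> p = p}. {a \<in> S. r a = r p} \<times> {v \<in> S. c v = c p})"
    for \<sigma>
  have finite_fibre: "finite (fibre \<sigma>)" for \<sigma>
    unfolding fibre_def by (intro finite_SigmaI) (auto simp: finite_S)
  have inS: "\<sigma> q \<in> S \<longleftrightarrow> q \<in> S" if "\<sigma> \<in> coset" for \<sigma> q
    using permutes_in_image[OF coset_permutes[OF that]] .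
  have "(\<Sum>\<sigma>\<in>coset. \<Sum>x\<in>choices \<sigma>. weight (fst x) * h (move \<sigma> x)) =
      (\<Sum>y\<in>Sigma coset choices. weight (fst (snd y)) * h (move (fst y) (snd y)))"
    by (simp add: sum.Sigma finite_coset finite_choices split_def)
  also have "\<dots> = (\<Sum>y\<in>Sigma coset fibre. weight (fst (snd y)) * h (fst y))"
  proof (rule sum.reindex_bij_witness[where
        i = "\<lambda>(\<rho>, p, a, v). (transpose p v \<circ> \<rho> \<circ> transpose p a, p, a)" and
        j = "\<lambda>(\<sigma>, p, a). (move \<sigma> (p, a), p, a, \<sigma> a)"], goal_cases)
    case (1 y)
    obtain \<sigma> p a where y: "y = (\<sigma>, p, a)" by (cases y)
    show ?case by (simp add: y move_def fun_eq_iff)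
  next
    case (2 y)
    then obtain \<sigma> p a where y: "y = (\<sigma>, p, a)" and \<sigma>: "\<sigma> \<in> coset" and x: "(p, a) \<in> choices \<sigma>"
      by auto
    have "move \<sigma> (p, a) p = p" by (simp add: move_def)
    then show ?case
      using move_in_coset[OF \<sigma> x] x inS[OF \<sigma>] by (auto simp: y fibre_def choices_def)
  next
    case (3 y)
    then obtain \<rho> p a v where y: "y = (\<rho>, p, a, v)" and "(p, a, v) \<in> fibre \<rho>"
      by auto
    then have "\<rho> p = p" by (simp add: fibre_def)
    then show ?case by (simp add: y move_def fun_eq_iff)
  next
    case (4 y)
    then obtain \<rho> p a v where y: "y = (\<rho>, p, a, v)" and \<rho>: "\<rho> \<in> coset" and f: "(p, a, v) \<in> fibre \<rho>"
      by auto
    then show ?case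
      using coset_closed[OF \<rho>, of p a v] by (auto simp: choices_def fibre_def)
  next
    case (5 y)
    obtain \<sigma> p a where y: "y = (\<sigma>, p, a)" by (cases y)
    show ?case by (simp add: y)
  qed
  also have "\<dots> = (\<Sum>\<sigma>\<in>coset. \<Sum>x\<in>fibre \<sigma>. weight (fst x) * h \<sigma>)"
    by (simp add: sum.Sigma finite_coset finite_fibre split_def)
  also have "\<dots> = (\<Sum>\<sigma>\<in>coset. real (fixes_of \<sigma>) * h \<sigma>)"
  proof (rule sum.cong[OF refl])
    fix \<sigma>
    have "(\<Sum>x\<in>fibre \<sigma>. weight (fst x) * h \<sigma>) =
        (\<Sum>p\<in>{p \<in> S. \<sigma> p = p}. \<Sum>x\<in>{a \<in> S. r a = r p} \<times> {v \<in> S. c v = c p}. weight p * h \<sigma>)"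
      unfolding fibre_def by (subst sum.Sigma) (auto simp: finite_S split_def)
    also have "\<dots> = (\<Sum>p\<in>{p \<in> S. \<sigma> p = p}. h \<sigma>)"
    proof (rule sum.cong[OF refl])
      fix p assume p: "p \<in> {p \<in> S. \<sigma> p = p}"
      then have "real (row_size p) * real (col_size p) * weight p = 1"
        using row_size_pos[of p] col_size_pos[of p] by (simp add: weight_def)
      then have "real (row_size p) * real (col_size p) * (weight p * h \<sigma>) = h \<sigma>"
        by (simp add: mult.assoc[symmetric])
      then show "(\<Sum>x\<in>{a \<in> S. r a = r p} \<times> {v \<in> S. c v = c p}. weight p * h \<sigma>) = h \<sigma>"
        by (simp add: card_cartesian_product row_size_def col_size_def)
    qed
    also have "\<dots> = real (fixes_of \<sigma>) * h \<sigma>" by (simp add: fixes_of_def)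
    finally show "(\<Sum>x\<in>fibre \<sigma>. weight (fst x) * h \<sigma>) = real (fixes_of \<sigma>) * h \<sigma>" .
  qed
  finally show ?thesis .
qed

lemma sum_fixes_of: "(\<Sum>\<sigma>\<in>coset. real (fixes_of \<sigma>)) = real (card coset) * mean_fixes"
  using size_bias_identity[of "\<lambda>_. 1"] by (simp add: sum_weight_choices)

section \<open>Fixed points gained by a move\<close>

lemma move_fixed_points_subset:
  assumes "\<sigma> permutes S" "\<sigma> b = p"
  shows "{x \<in> S. move \<sigma> (p, a) x = x} \<subseteq> {x \<in> S. \<sigma> x = x} \<union> {x \<in> {p, a, b}. move \<sigma> (p, a) x = x}"
proof (intro subsetI UnCI)
  fix x
  assume x: "x \<in> {x \<in> S. move \<sigma> (p, a) x = x}" "x \<notin> {x \<in> {p, a, b}. move \<sigma> (p, a) x = x}"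
  then have "x \<noteq> p" "x \<noteq> a" "x \<noteq> b" by auto
  then have "\<sigma> x \<noteq> \<sigma> a" "\<sigma> x \<noteq> p"
    using permutes_inj[OF assms(1)] assms(2) by (auto dest: injD)
  then show "x \<in> {x \<in> S. \<sigma> x = x}"
    using x \<open>x \<noteq> p\<close> \<open>x \<noteq> a\<close> by (auto simp: move_def transpose_def)
qed

text \<open>
  With \<open>b\<close> the preimage of \<open>p\<close>, the move changes \<open>\<sigma>\<close> only at \<open>p\<close>, \<open>a\<close> and \<open>b\<close>, so at most these three
  points can become fixed.
\<close>

lemma gain_le_new:
  assumes "\<sigma> permutes S" "\<sigma> b = p"
  shows "gain \<sigma> (p, a) \<le> real (card ({x \<in> {p, a, b}. move \<sigma> (p, a) x = x \<and> \<sigma> x \<noteq> x}))"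
proof -
  let ?N = "{x \<in> {p, a, b}. move \<sigma> (p, a) x = x \<and> \<sigma> x \<noteq> x}"
  have "x \<in> S" if "\<sigma> x \<noteq> x" for x
    using permutes_not_in[OF assms(1)] that by blast
  then have "{x \<in> S. move \<sigma> (p, a) x = x} \<subseteq> {x \<in> S. \<sigma> x = x} \<union> ?N"
    using move_fixed_points_subset[OF assms, of a] by blast
  then have "fixes_of (move \<sigma> (p, a)) \<le> card ({x \<in> S. \<sigma> x = x} \<union> ?N)"
    unfolding fixes_of_def by (intro card_mono) (auto simp: finite_S)
  also have "\<dots> \<le> fixes_of \<sigma> + card ?N"
    unfolding fixes_of_def by (rule card_Un_le)
  finally show ?thesis by (simp add: gain_def)
qed

lemma gain_le_3:
  assumes "\<sigma> permutes S"
  shows "gain \<sigma> (p, a) \<le> 3"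
proof -
  obtain b where b: "\<sigma> b = p" using permutes_surj[OF assms] by (metis surjD)
  have "card {x \<in> {p, a, b}. move \<sigma> (p, a) x = x \<and> \<sigma> x \<noteq> x} \<le> card {p, a, b}"
    by (intro card_mono) auto
  also have "\<dots> \<le> 3" by (simp add: card_insert_if)
  finally show ?thesis using gain_le_new[OF assms b, of a] by linarith
qed

text \<open>
  If \<open>p\<close>, \<open>a\<close> and \<open>b\<close> all become fixed, then \<open>p \<mapsto> a \<mapsto> b \<mapsto> p\<close> was a 3-cycle of \<open>\<sigma>\<close>. For each \<open>p\<close>
  only the choice \<open>a = \<sigma> p\<close> can therefore gain more than two fixed points.
\<close>

lemma gain_gt_2D:
  assumes "\<sigma> permutes S" "gain \<sigma> (p, a) > 2"
  shows "\<sigma> p = a" "\<sigma> (\<sigma> a) = p" "p \<noteq> a" "\<sigma> a \<noteq> p" "\<sigma> a \<noteq> a"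
proof -
  obtain b where b: "\<sigma> b = p" using permutes_surj[OF assms(1)] by (metis surjD)
  define N where "N = {x \<in> {p, a, b}. move \<sigma> (p, a) x = x \<and> \<sigma> x \<noteq> x}"
  have N3: "3 \<le> card N"
    using gain_le_new[OF assms(1) b, of a] assms(2) unfolding N_def by linarith
  have sub: "N \<subseteq> {p, a, b}" by (auto simp: N_def)
  have "card {p, a, b} \<le> 3" by (simp add: card_insert_if)
  then have N: "N = {p, a, b}" and c3: "card {p, a, b} = 3"
    using card_mono[OF _ sub] card_subset_eq[OF _ sub] N3 by auto
  have d: "p \<noteq> a" "p \<noteq> b" "a \<noteq> b"
    using c3 by (auto simp: card_insert_if split: if_splits)
  have inj: "\<sigma> x = \<sigma> y \<longleftrightarrow> x = y" for x y
    using permutes_inj[OF assms(1)] by (auto dest: injD)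
  have f: "move \<sigma> (p, a) a = a" "move \<sigma> (p, a) b = b" "\<sigma> p \<noteq> p"
    using N by (auto simp: N_def)
  show pa: "\<sigma> p = a"
    using f(1,3) d inj[of p a] by (auto simp: move_def transpose_def split: if_splits)
  have ab: "\<sigma> a = b"
    using f(2) d b by (auto simp: move_def transpose_def split: if_splits)
  show "\<sigma> (\<sigma> a) = p" "p \<noteq> a" "\<sigma> a \<noteq> p" "\<sigma> a \<noteq> a" using ab b d by auto
qed

text \<open>
  If \<open>a\<close> is the preimage of \<open>p\<close>, or \<open>a = p\<close>, then the move is multiplication by a single
  transposition, and on a 3-cycle it only splits off \<open>p\<close>. These are the cheap choices that
  compensate the choices gaining three fixed points.
\<close>

lemma gain_preimage_le_1:
  assumes "\<sigma> permutes S" "\<sigma> a = p" "\<sigma> p \<noteq> a"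
  shows "gain \<sigma> (p, a) \<le> 1"
proof -
  have "{x \<in> {p, a, a}. move \<sigma> (p, a) x = x \<and> \<sigma> x \<noteq> x} \<subseteq> {p}"
    using assms(2,3) by (auto simp: move_def transpose_def)
  from card_mono[OF _ this] have "card {x \<in> {p, a, a}. move \<sigma> (p, a) x = x \<and> \<sigma> x \<noteq> x} \<le> 1"
    by simp
  then show ?thesis using gain_le_new[OF assms(1,2), of a] by linarith
qed

lemma gain_self_le_1:
  assumes "\<sigma> permutes S" "\<sigma> b = p" "\<sigma> p \<noteq> b"
  shows "gain \<sigma> (p, p) \<le> 1"
proof -
  have "{x \<in> {p, p, b}. move \<sigma> (p, p) x = x \<and> \<sigma> x \<noteq> x} \<subseteq> {p}"
    using assms(2,3) by (auto simp: move_def transpose_def)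
  from card_mono[OF _ this] have "card {x \<in> {p, p, b}. move \<sigma> (p, p) x = x \<and> \<sigma> x \<noteq> x} \<le> 1"
    by simp
  then show ?thesis using gain_le_new[OF assms(1,2), of p] by linarith
qed

end

section \<open>Compensation of the gain of three\<close>

text \<open>
  On a 3-cycle \<open>p \<mapsto> a \<mapsto> b \<mapsto> p\<close> that gives a gain of three, \<open>a\<close> is in the row and \<open>b\<close> in the column of
  \<open>p\<close>. The assumption ensures that at least one of them has no smaller weight than \<open>p\<close>; for the
  blocks of two partitions it follows from their order.
\<close>

locale noncrossing_table_coset = table_coset +
  assumes noncrossing: "\<lbrakk>p \<in> S; a \<in> S; b \<in> S; r a = r p; c b = c p\<rbrakk>
    \<Longrightarrow> row_size b \<le> row_size p \<or> col_size a \<le> col_size p"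
begin

text \<open>
  For a choice gaining three fixed points on a 3-cycle \<open>p \<mapsto> a \<mapsto> b \<mapsto> p\<close>, the choices \<open>(a, p)\<close> and
  \<open>(b, b)\<close> are always available and gain at most one. One of them weighs at least as much as
  \<open>(p, a)\<close>: the first one unless the column of \<open>a\<close> is larger than that of \<open>p\<close>, and in that case the
  second one, because the row of \<open>b\<close> cannot be larger as well.
\<close>

definition partner :: "('a \<Rightarrow> 'a) \<Rightarrow> 'a \<times> 'a \<Rightarrow> 'a \<times> 'a" where
  "partner \<sigma> = (\<lambda>(p, a). if col_size a \<le> col_size p then (a, p) else (\<sigma> a, \<sigma> a))"

lemma partner_props:
  assumes \<sigma>: "\<sigma> \<in> coset" and x: "x \<in> choices \<sigma>" and g: "gain \<sigma> x > 2"
  shows "partner \<sigma> x \<in> choices \<sigma>" "gain \<sigma> (partner \<sigma> x) \<le> 1"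
    "weight (fst x) \<le> weight (fst (partner \<sigma> x))"
proof -
  obtain p a where xpa: "x = (p, a)" by force
  note perm = coset_permutes[OF \<sigma>]
  have pS: "p \<in> S" and aS: "a \<in> S" and ra: "r a = r p" and cb: "c (\<sigma> a) = c p"
    using x by (auto simp: xpa choices_def)
  have bS: "\<sigma> a \<in> S" using permutes_in_image[OF perm] aS by blast
  note cyc = gain_gt_2D[OF perm g[unfolded xpa]]
  have "partner \<sigma> x \<in> choices \<sigma> \<and> gain \<sigma> (partner \<sigma> x) \<le> 1 \<and>
    weight (fst x) \<le> weight (fst (partner \<sigma> x))"
  proof (cases "col_size a \<le> col_size p")
    case True
    have "row_size a = row_size p" using ra by (simp add: row_size_def)
    then have "weight p \<le> weight a"
      using True row_size_pos[OF pS] col_size_pos[OF aS]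
      by (auto simp: weight_def intro!: divide_left_mono mult_left_mono)
    moreover have "gain \<sigma> (a, p) \<le> 1"
      using gain_preimage_le_1[OF perm, of p a] cyc by simp
    ultimately show ?thesis
      using True pS aS ra cyc by (simp add: partner_def xpa choices_def)
  next
    case False
    then have row: "row_size (\<sigma> a) \<le> row_size p"
      using noncrossing[OF pS aS bS ra cb] by simp
    have "col_size (\<sigma> a) = col_size p" using cb by (simp add: col_size_def)
    then have "weight p \<le> weight (\<sigma> a)"
      using row row_size_pos[OF bS] col_size_pos[OF pS]
      by (auto simp: weight_def intro!: divide_left_mono mult_right_mono)
    moreover have "gain \<sigma> (\<sigma> a, \<sigma> a) \<le> 1"
      using gain_self_le_1[OF perm, of a "\<sigma> a"] cyc by simp
    ultimately show ?thesis
      using False bS cb cyc by (simp add: partner_def xpa choices_def)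
  qed
  then show "partner \<sigma> x \<in> choices \<sigma>" "gain \<sigma> (partner \<sigma> x) \<le> 1"
    "weight (fst x) \<le> weight (fst (partner \<sigma> x))" by auto
qed

text \<open>
  Partners of the two kinds differ in whether their components agree, and within one kind the
  partner determines \<open>p\<close>.
\<close>

lemma inj_on_partner:
  assumes \<sigma>: "\<sigma> \<in> coset"
  shows "inj_on (partner \<sigma>) {x \<in> choices \<sigma>. gain \<sigma> x > 2}"
proof (rule inj_onI)
  fix x y
  assume x: "x \<in> {x \<in> choices \<sigma>. gain \<sigma> x > 2}" and y: "y \<in> {x \<in> choices \<sigma>. gain \<sigma> x > 2}"
    and e: "partner \<sigma> x = partner \<sigma> y"
  obtain p a q b where xy: "x = (p, a)" "y = (q, b)" by force
  note perm = coset_permutes[OF \<sigma>]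
  have gx: "gain \<sigma> (p, a) > 2" and gy: "gain \<sigma> (q, b) > 2" using x y xy by auto
  note cyc = gain_gt_2D[OF perm gx] gain_gt_2D[OF perm gy]
  have inj: "\<sigma> u = \<sigma> v \<longleftrightarrow> u = v" for u v
    using permutes_inj[OF perm] by (auto dest: injD)
  have "p = q"
    using e cyc inj[of a b] inj[of p q] by (auto simp: xy partner_def split: if_splits)
  then show "x = y" using cyc xy by simp
qed

text \<open>
  On average a move gains at most two fixed points, in the sense tested by \<open>\<phi>\<close>: choices gaining
  three are paired with at least equally heavy choices gaining at most one, and everything else
  gains at most two.
\<close>

lemma sum_gain_le:
  fixes \<phi> :: "real \<Rightarrow> real"
  assumes \<sigma>: "\<sigma> \<in> coset" and mono: "mono \<phi>"
    and C2: "\<phi> 2 \<le> C" and C13: "\<phi> 1 + \<phi> 3 \<le> 2 * C"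
  shows "(\<Sum>x\<in>choices \<sigma>. weight (fst x) * \<phi> (gain \<sigma> x)) \<le> C * mean_fixes"
proof -
  let ?w = "\<lambda>x. weight (fst x)"
  define f where "f x = ?w x * (\<phi> (gain \<sigma> x) - C)" for x
  define B where "B = {x \<in> choices \<sigma>. gain \<sigma> x > 2}"
  have perm: "\<sigma> permutes S" by (rule coset_permutes[OF \<sigma>])
  have fin: "finite (choices \<sigma>)" "finite B"
    by (auto simp: B_def finite_choices)
  have \<phi>1: "\<phi> 1 \<le> C" using monoD[OF mono, of 1 2] C2 by simp
  have sub: "partner \<sigma> ` B \<subseteq> choices \<sigma> - B"
    using partner_props[OF \<sigma>] by (force simp: B_def)
  have pair: "f x + f (partner \<sigma> x) \<le> 0" if "x \<in> B" for x
  proof -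
    have x: "x \<in> choices \<sigma>" "gain \<sigma> x > 2" using that by (auto simp: B_def)
    note pp = partner_props[OF \<sigma> x]
    have "gain \<sigma> x \<le> 3" using gain_le_3[OF perm] by (cases x) auto
    then have "f x \<le> ?w x * (\<phi> 3 - C)"
      unfolding f_def using monoD[OF mono] by (intro mult_left_mono) (auto simp: weight_nonneg)
    also have "\<dots> \<le> ?w x * (C - \<phi> 1)"
      using C13 by (intro mult_left_mono) (auto simp: weight_nonneg)
    also have "\<dots> \<le> ?w (partner \<sigma> x) * (C - \<phi> 1)"
      using pp(3) \<phi>1 by (intro mult_right_mono) auto
    also have "\<dots> \<le> ?w (partner \<sigma> x) * (C - \<phi> (gain \<sigma> (partner \<sigma> x)))"
      using monoD[OF mono pp(2)] by (intro mult_left_mono) (auto simp: weight_nonneg)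
    finally show ?thesis unfolding f_def by (simp add: algebra_simps)
  qed
  have rest: "f x \<le> 0" if "x \<in> choices \<sigma> - B" for x
  proof -
    have "\<phi> (gain \<sigma> x) \<le> C"
      using that monoD[OF mono, of "gain \<sigma> x" 2] C2 by (auto simp: B_def)
    then show ?thesis unfolding f_def by (simp add: mult_nonneg_nonpos weight_nonneg)
  qed
  have "sum f (choices \<sigma>) = sum f (choices \<sigma> - B) + sum f B"
    by (rule sum.subset_diff) (auto simp: B_def fin)
  also have "sum f (choices \<sigma> - B) = sum f (choices \<sigma> - B - partner \<sigma> ` B) + sum f (partner \<sigma> ` B)"
    by (rule sum.subset_diff[OF sub]) (simp add: fin)
  also have "sum f (partner \<sigma> ` B) = (\<Sum>x\<in>B. f (partner \<sigma> x))"
    using inj_on_partner[OF \<sigma>] by (simp add: sum.reindex B_def)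
  also have "sum f (choices \<sigma> - B - partner \<sigma> ` B) \<le> 0"
    using rest by (intro sum_nonpos) auto
  finally have "sum f (choices \<sigma>) \<le> (\<Sum>x\<in>B. f x + f (partner \<sigma> x))"
    by (simp add: sum.distrib)
  also have "\<dots> \<le> 0" using pair by (rule sum_nonpos)
  finally have "sum f (choices \<sigma>) \<le> 0" .
  then show ?thesis
    by (simp add: f_def right_diff_distrib sum_subtractf sum_weight_choices[OF \<sigma>]
        flip: sum_distrib_right) (simp add: mult.commute)
qed

lemma fixes_of_move: "real (fixes_of (move \<sigma> x)) = real (fixes_of \<sigma>) + gain \<sigma> x"
  by (simp add: gain_def)

text \<open>
  The size-bias identity turns \<open>E[W exp (\<theta> W)]\<close> into an average of \<open>exp (\<theta> W) exp (\<theta> * gain)\<close>. The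
  sign \<open>s\<close> makes one statement serve for both tails: \<open>\<phi> x = s * exp (\<theta> * x)\<close> has to be increasing,
  so \<open>s\<close> has the sign of \<open>\<theta>\<close>.
\<close>

lemma sum_fixes_exp_le:
  assumes mono: "mono (\<lambda>x. s * exp (\<theta> * x))"
    and C2: "s * exp (\<theta> * 2) \<le> C" and C13: "s * exp \<theta> + s * exp (\<theta> * 3) \<le> 2 * C"
  shows "s * (\<Sum>\<sigma>\<in>coset. real (fixes_of \<sigma>) * exp (\<theta> * real (fixes_of \<sigma>))) \<le>
    C * mean_fixes * (\<Sum>\<sigma>\<in>coset. exp (\<theta> * real (fixes_of \<sigma>)))"
proof -
  have "s * (\<Sum>\<sigma>\<in>coset. real (fixes_of \<sigma>) * exp (\<theta> * real (fixes_of \<sigma>))) =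
      (\<Sum>\<sigma>\<in>coset. \<Sum>x\<in>choices \<sigma>. weight (fst x) * (s * exp (\<theta> * real (fixes_of (move \<sigma> x)))))"
    using size_bias_identity[of "\<lambda>\<rho>. s * exp (\<theta> * real (fixes_of \<rho>))"]
    by (simp add: sum_distrib_left mult.left_commute)
  also have "\<dots> = (\<Sum>\<sigma>\<in>coset. exp (\<theta> * real (fixes_of \<sigma>)) *
      (\<Sum>x\<in>choices \<sigma>. weight (fst x) * (s * exp (\<theta> * gain \<sigma> x))))"
    by (simp add: fixes_of_move distrib_left exp_add sum_distrib_left mult_ac)
  also have "\<dots> \<le> (\<Sum>\<sigma>\<in>coset. exp (\<theta> * real (fixes_of \<sigma>)) * (C * mean_fixes))"
    using sum_gain_le[OF _ mono C2] C13 by (intro sum_mono mult_left_mono) auto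
  also have "\<dots> = C * mean_fixes * (\<Sum>\<sigma>\<in>coset. exp (\<theta> * real (fixes_of \<sigma>)))"
    by (simp add: sum_distrib_left mult_ac)
  finally show ?thesis .
qed

end

section \<open>Exponential moments and tail bounds\<close>

text \<open>
  This and the next lemma provide \<open>C = 1 / (1 - \<theta>)\<^sup>2\<close> as the bound for the upper tail. The
  average of \<open>exp \<theta>\<close> and \<open>exp (3 * \<theta>)\<close> exceeds \<open>exp (2 * \<theta>)\<close> only in second order, which
  \<open>1 / (1 - \<theta>)\<^sup>2\<close> absorbs; and \<open>C\<close> is the derivative of \<open>\<theta> / (1 - \<theta>)\<close>, so it integrates to a
  sub-gamma bound with the right constants.
\<close>

lemma exp_average_le_inverse_square:
  fixes \<theta> :: real
  assumes "0 \<le> \<theta>" "\<theta> < 1"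
  shows "exp \<theta> + exp (\<theta> * 3) \<le> 2 * (1 / (1 - \<theta>)\<^sup>2)"
proof -
  define g where "g x = (1 - x)\<^sup>2 * (exp x + exp (x * 3))" for x :: real
  have "g \<theta> \<le> g 0"
  proof (rule DERIV_nonpos_imp_nonincreasing[OF assms(1)])
    fix x assume x: "0 \<le> x" "x \<le> \<theta>"
    have "1 - 3 * x \<le> (1 + x) * (1 - 2 * x)"
      using mult_mono[of x 1 x x] x assms by (simp add: algebra_simps)
    also have "\<dots> \<le> (1 + x) * exp (- (2 * x))"
      using exp_ge_add_one_self[of "- (2 * x)"] x by (intro mult_left_mono) auto
    finally have "(1 - 3 * x) * exp (2 * x) \<le> (1 + x) * exp (- (2 * x)) * exp (2 * x)"
      by (rule mult_right_mono) simp
    then have key: "(1 - 3 * x) * exp (2 * x) \<le> 1 + x"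
      by (simp add: mult.assoc flip: exp_add)
    have e3: "exp (x * 3) = exp x * exp (2 * x)"
      by (simp flip: exp_add)
    have "(g has_real_derivative
        (1 - x) * exp x * ((1 - 3 * x) * exp (2 * x) - (1 + x))) (at x)"
      unfolding g_def
      by (auto intro!: derivative_eq_intros simp: e3 algebra_simps power2_eq_square)
    moreover have "(1 - x) * exp x * ((1 - 3 * x) * exp (2 * x) - (1 + x)) \<le> 0"
      using key x assms by (intro mult_nonneg_nonpos) auto
    ultimately show "\<exists>y. (g has_real_derivative y) (at x) \<and> y \<le> 0" by blast
  qed
  then show ?thesis
    using assms by (simp add: g_def field_simps)
qed

lemma exp_double_le_inverse_square:
  fixes \<theta> :: real
  assumes "0 \<le> \<theta>" "\<theta> < 1"
  shows "exp (\<theta> * 2) \<le> 1 / (1 - \<theta>)\<^sup>2"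
proof -
  have "(1 - \<theta>)\<^sup>2 \<le> (exp (- \<theta>))\<^sup>2"
    using exp_ge_add_one_self[of "- \<theta>"] assms by (intro power_mono) auto
  also have "\<dots> = 1 / exp (\<theta> * 2)"
    by (simp add: exp_minus field_simps flip: exp_of_nat_mult)
  finally show ?thesis using assms by (simp add: field_simps)
qed

text \<open>
  Gronwall's argument: the bound on the logarithmic derivative says that the exponential sum times
  \<open>exp (- u x)\<close> is nonincreasing in \<open>x\<close>.
\<close>

lemma sum_exp_le_of_log_derivative:
  fixes X :: "'b \<Rightarrow> real" and u u' :: "real \<Rightarrow> real"
  assumes "0 \<le> \<theta>"
    and u: "\<And>x. 0 \<le> x \<Longrightarrow> x \<le> \<theta> \<Longrightarrow> (u has_real_derivative u' x) (at x)"
    and le: "\<And>x. 0 \<le> x \<Longrightarrow> x \<le> \<theta> \<Longrightarrow>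
      (\<Sum>\<sigma>\<in>G. X \<sigma> * exp (x * X \<sigma>)) \<le> u' x * (\<Sum>\<sigma>\<in>G. exp (x * X \<sigma>))"
    and "u 0 = 0"
  shows "(\<Sum>\<sigma>\<in>G. exp (\<theta> * X \<sigma>)) \<le> real (card G) * exp (u \<theta>)"
proof -
  define g where "g x = (\<Sum>\<sigma>\<in>G. exp (x * X \<sigma>)) * exp (- u x)" for x
  have "g \<theta> \<le> g 0"
  proof (rule DERIV_nonpos_imp_nonincreasing[OF assms(1)])
    fix x assume x: "0 \<le> x" "x \<le> \<theta>"
    have "(g has_real_derivative ((\<Sum>\<sigma>\<in>G. X \<sigma> * exp (x * X \<sigma>)) -
        u' x * (\<Sum>\<sigma>\<in>G. exp (x * X \<sigma>))) * exp (- u x)) (at x)"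
      unfolding g_def using u[OF x]
      by (auto intro!: derivative_eq_intros simp: algebra_simps)
    moreover have "((\<Sum>\<sigma>\<in>G. X \<sigma> * exp (x * X \<sigma>)) -
        u' x * (\<Sum>\<sigma>\<in>G. exp (x * X \<sigma>))) * exp (- u x) \<le> 0"
      using le[OF x] by (intro mult_nonpos_nonneg) auto
    ultimately show "\<exists>y. (g has_real_derivative y) (at x) \<and> y \<le> 0" by blast
  qed
  then show ?thesis
    using assms(4) by (simp add: g_def exp_minus field_simps)
qed

text \<open>
  This is Chernoff's bound: Markov's inequality for \<open>exp (\<theta> * X)\<close> under the counting measure.
\<close>

lemma card_le_of_sum_exp:
  fixes X :: "'b \<Rightarrow> real"
  assumes "finite G" and le: "(\<Sum>\<sigma>\<in>G. exp (\<theta> * X \<sigma>)) \<le> real (card G) * exp K" and "0 \<le> \<theta>"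
  shows "real (card {\<sigma> \<in> G. y \<le> X \<sigma>}) \<le> real (card G) * exp (K - \<theta> * y)"
proof -
  have "real (card {\<sigma> \<in> G. y \<le> X \<sigma>}) * exp (\<theta> * y) = (\<Sum>\<sigma>\<in>{\<sigma> \<in> G. y \<le> X \<sigma>}. exp (\<theta> * y))"
    by simp
  also have "\<dots> \<le> (\<Sum>\<sigma>\<in>{\<sigma> \<in> G. y \<le> X \<sigma>}. exp (\<theta> * X \<sigma>))"
    using assms(3) by (intro sum_mono) (auto intro: mult_left_mono)
  also have "\<dots> \<le> (\<Sum>\<sigma>\<in>G. exp (\<theta> * X \<sigma>))"
    using assms(1) by (intro sum_mono2) auto
  also have "\<dots> \<le> real (card G) * exp K" by (rule le)
  finally show ?thesis by (simp add: exp_diff field_simps)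
qed

context noncrossing_table_coset
begin

lemma upper_tail:
  assumes M: "mean_fixes > 0" and x: "x > 0"
  shows "real (card {\<sigma> \<in> coset. mean_fixes + x \<le> real (fixes_of \<sigma>)}) \<le>
    real (card coset) * exp (- (x\<^sup>2 / (4 * mean_fixes + 2 * x)))"
proof -
  let ?M = mean_fixes
  \<comment> \<open>With the bound \<open>?M * \<theta>\<^sup>2 / (1 - \<theta>)\<close> for the logarithm of the centred moment generating
  function, this \<open>\<theta>\<close> gives exactly the exponent \<open>- x\<^sup>2 / (4 * ?M + 2 * x)\<close>.\<close>
  define \<theta> where "\<theta> = x / (2 * ?M + x)"
  have \<theta>: "0 \<le> \<theta>" "\<theta> < 1" using M x by (auto simp: \<theta>_def)
  have mgf: "(\<Sum>\<sigma>\<in>coset. exp (\<theta> * real (fixes_of \<sigma>))) \<le>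
      real (card coset) * exp (?M * (1 / (1 - \<theta>) - 1))"
  proof (rule sum_exp_le_of_log_derivative[where u' = "\<lambda>y. 1 / (1 - y)\<^sup>2 * ?M", OF \<theta>(1)])
    fix y :: real assume "0 \<le> y" "y \<le> \<theta>"
    then have y: "0 \<le> y" "y < 1" using \<theta> by auto
    show "((\<lambda>y. ?M * (1 / (1 - y) - 1)) has_real_derivative 1 / (1 - y)\<^sup>2 * ?M) (at y)"
      using y by (auto intro!: derivative_eq_intros simp: power2_eq_square)
    show "(\<Sum>\<sigma>\<in>coset. real (fixes_of \<sigma>) * exp (y * real (fixes_of \<sigma>))) \<le>
        1 / (1 - y)\<^sup>2 * ?M * (\<Sum>\<sigma>\<in>coset. exp (y * real (fixes_of \<sigma>)))"
      using sum_fixes_exp_le[where s = 1 and \<theta> = y and C = "1 / (1 - y)\<^sup>2"] y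
        exp_average_le_inverse_square[OF y] exp_double_le_inverse_square[OF y]
      by (simp add: mono_def mult_left_mono)
  qed simp
  have half: "?M * (1 / (1 - \<theta>) - 1) = x / 2"
    using M x by (simp add: \<theta>_def field_simps)
  have "x / 2 - \<theta> * (?M + x) = - (x\<^sup>2 / (4 * ?M + 2 * x))"
    using M x by (simp add: \<theta>_def field_simps power2_eq_square)
  then show ?thesis
    using card_le_of_sum_exp[OF finite_coset mgf[unfolded half] \<theta>(1), of "?M + x"] by simp
qed

lemma lower_tail:
  assumes M: "mean_fixes > 0" and x: "x > 0"
  shows "real (card {\<sigma> \<in> coset. real (fixes_of \<sigma>) \<le> mean_fixes - x}) \<le>
    real (card coset) * exp (- (x\<^sup>2 / (4 * mean_fixes)))"
proof -
  let ?M = mean_fixes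
  \<comment> \<open>This \<open>\<theta>\<close> minimises \<open>?M * \<theta>\<^sup>2 - \<theta> * x\<close>.\<close>
  define \<theta> where "\<theta> = x / (2 * ?M)"
  have \<theta>: "0 \<le> \<theta>" using M x by (auto simp: \<theta>_def)
  have mgf: "(\<Sum>\<sigma>\<in>coset. exp (\<theta> * - real (fixes_of \<sigma>))) \<le>
      real (card coset) * exp (?M * (\<theta>\<^sup>2 - \<theta>))"
  proof (rule sum_exp_le_of_log_derivative[where u' = "\<lambda>y. (2 * y - 1) * ?M", OF \<theta>(1)])
    fix y :: real assume y: "0 \<le> y" "y \<le> \<theta>"
    show "((\<lambda>y. ?M * (y\<^sup>2 - y)) has_real_derivative (2 * y - 1) * ?M) (at y)"
      by (auto intro!: derivative_eq_intros)
    have "- exp (- (2 * y)) \<le> 2 * y - 1"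
      using exp_ge_add_one_self[of "- (2 * y)"] by linarith
    moreover have "- exp (- y) - exp (- (3 * y)) \<le> 2 * (2 * y - 1)"
      using exp_ge_add_one_self[of "- y"] exp_ge_add_one_self[of "- (3 * y)"]
      by (simp add: algebra_simps)
    moreover have "mono (\<lambda>x. - 1 * exp (- y * x))"
      using y by (auto simp: mono_def intro: mult_left_mono)
    ultimately show "(\<Sum>\<sigma>\<in>coset. - real (fixes_of \<sigma>) * exp (y * - real (fixes_of \<sigma>))) \<le>
        (2 * y - 1) * ?M * (\<Sum>\<sigma>\<in>coset. exp (y * - real (fixes_of \<sigma>)))"
      using sum_fixes_exp_le[of "- 1" "- y" "2 * y - 1"]
      by (simp add: sum_negf mult.commute)
  qed simp
  have "?M * (\<theta>\<^sup>2 - \<theta>) - \<theta> * - (?M - x) = - (x\<^sup>2 / (4 * ?M))"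
    using M x by (simp add: \<theta>_def field_simps power2_eq_square)
  moreover have "{\<sigma> \<in> coset. - (?M - x) \<le> - real (fixes_of \<sigma>)} =
      {\<sigma> \<in> coset. real (fixes_of \<sigma>) \<le> ?M - x}" by auto
  ultimately show ?thesis
    using card_le_of_sum_exp[OF finite_coset mgf \<theta>(1), of "- (?M - x)"] by simp
qed

end

section \<open>Permutations with a given table\<close>

lemma bij_betw_matching_labels:
  assumes fin: "finite A" "finite X"
    and card: "\<And>i. card {a \<in> A. f a = i} = card {x \<in> X. f' x = i}"
  shows "\<exists>g. bij_betw g A X \<and> (\<forall>a\<in>A. f' (g a) = f a)"
proof -
  have "\<exists>h. bij_betw h {a \<in> A. f a = i} {x \<in> X. f' x = i}" for i
    using fin card by (intro finite_same_card_bij) auto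
  then obtain h where h: "\<And>i. bij_betw (h i) {a \<in> A. f a = i} {x \<in> X. f' x = i}"
    by metis
  define g where "g a = h (f a) a" for a
  have g: "g a \<in> X" "f' (g a) = f a" if "a \<in> A" for a
    using bij_betwE[OF h[of "f a"]] that by (auto simp: g_def)
  have "inj_on g A"
  proof (rule inj_onI)
    fix a b assume ab: "a \<in> A" "b \<in> A" "g a = g b"
    then have "f a = f b" using g by metis
    then show "a = b"
      using ab inj_onD[OF bij_betw_imp_inj_on[OF h[of "f b"]], of a b] by (simp add: g_def)
  qed
  moreover have "x \<in> g ` A" if "x \<in> X" for x
  proof -
    have "x \<in> h (f' x) ` {a \<in> A. f a = f' x}"
      using that bij_betw_imp_surj_on[OF h[of "f' x"]] by auto
    then obtain a where "a \<in> A" "f a = f' x" "x = h (f' x) a" by auto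
    then have "x = g a" by (simp add: g_def)
    then show ?thesis using \<open>a \<in> A\<close> by simp
  qed
  ultimately have "bij_betw g A X" using g by (auto simp: bij_betw_def)
  then show ?thesis using g by blast
qed

text \<open>
  Cut the entry in cell \<open>(i, j)\<close> into unit tokens \<open>(i, j, k)\<close>, \<open>k < T i j\<close>. The row sums allow the
  positions to be matched with the tokens so that rows agree, the column sums do the same for the
  values, and the permutation sends a position to the value with the same token.
\<close>

lemma exists_permutation_with_table:
  fixes S :: "'a set" and r c :: "'a \<Rightarrow> nat"
  assumes fin: "finite S"
    and r: "\<And>p. p \<in> S \<Longrightarrow> r p < I" and c: "\<And>p. p \<in> S \<Longrightarrow> c p < J"
    and row: "\<And>i. i < I \<Longrightarrow> (\<Sum>j<J. T i j) = card {p \<in> S. r p = i}"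
    and col: "\<And>j. j < J \<Longrightarrow> (\<Sum>i<I. T i j) = card {p \<in> S. c p = j}"
  shows "\<exists>\<sigma>. \<sigma> permutes S \<and> (\<forall>i<I. \<forall>j<J. card {p \<in> S. r p = i \<and> c (\<sigma> p) = j} = T i j)"
proof -
  define X where "X = (SIGMA i:{..<I}. SIGMA j:{..<J}. {..<T i j})"
  have finX: "finite X" by (auto simp: X_def)
  have "card {p \<in> S. r p = i} = card {x \<in> X. fst x = i}" for i
  proof (cases "i < I")
    case True
    then have "{x \<in> X. fst x = i} = {i} \<times> (SIGMA j:{..<J}. {..<T i j})"
      by (auto simp: X_def)
    then show ?thesis using row[OF True] by (simp add: card_cartesian_product)
  next
    case False
    then have "{x \<in> X. fst x = i} = {}" "{p \<in> S. r p = i} = {}"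
      using r by (auto simp: X_def)
    then show ?thesis by (simp only: card.empty)
  qed
  from bij_betw_matching_labels[OF fin finX this]
  obtain g where g: "bij_betw g S X" "\<And>p. p \<in> S \<Longrightarrow> fst (g p) = r p" by blast
  have "card {p \<in> S. c p = j} = card {x \<in> X. fst (snd x) = j}" for j
  proof (cases "j < J")
    case True
    then have "{x \<in> X. fst (snd x) = j} = (SIGMA i:{..<I}. {j} \<times> {..<T i j})"
      by (auto simp: X_def)
    then show ?thesis using col[OF True] by (simp add: card_cartesian_product)
  next
    case False
    then have "{x \<in> X. fst (snd x) = j} = {}" "{p \<in> S. c p = j} = {}"
      using c by (auto simp: X_def)
    then show ?thesis by (simp only: card.empty)
  qed
  from bij_betw_matching_labels[OF fin finX this]
  obtain h where h: "bij_betw h S X" "\<And>p. p \<in> S \<Longrightarrow> fst (snd (h p)) = c p" by blast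
  define \<sigma> where "\<sigma> p = (if p \<in> S then inv_into S h (g p) else p)" for p
  have "bij_betw (inv_into S h \<circ> g) S S"
    using bij_betw_trans[OF g(1) bij_betw_inv_into[OF h(1)]] .
  then have "bij_betw \<sigma> S S"
    by (rule bij_betw_cong[THEN iffD1, rotated]) (simp add: \<sigma>_def)
  then have "\<sigma> permutes S"
    by (rule bij_imp_permutes) (simp add: \<sigma>_def)
  moreover have "card {p \<in> S. r p = i \<and> c (\<sigma> p) = j} = T i j" if ij: "i < I" "j < J" for i j
  proof -
    have cs: "c (\<sigma> p) = fst (snd (g p))" if p: "p \<in> S" for p
    proof -
      have "g p \<in> h ` S" using bij_betwE[OF g(1)] bij_betw_imp_surj_on[OF h(1)] p by blast
      then show ?thesis
        using h(2)[OF inv_into_into] by (metis \<sigma>_def f_inv_into_f p)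
    qed
    have "g ` {p \<in> S. r p = i \<and> c (\<sigma> p) = j} = {x \<in> X. fst x = i \<and> fst (snd x) = j}"
    proof (intro equalityI subsetI)
      fix x assume x: "x \<in> {x \<in> X. fst x = i \<and> fst (snd x) = j}"
      then obtain p where "p \<in> S" "x = g p" using bij_betw_imp_surj_on[OF g(1)] by blast
      then show "x \<in> g ` {p \<in> S. r p = i \<and> c (\<sigma> p) = j}" using x g(2) cs by auto
    next
      fix x assume "x \<in> g ` {p \<in> S. r p = i \<and> c (\<sigma> p) = j}"
      then show "x \<in> {x \<in> X. fst x = i \<and> fst (snd x) = j}"
        using bij_betwE[OF g(1)] g(2) cs by auto
    qed
    also have "\<dots> = {i} \<times> {j} \<times> {..<T i j}" using ij by (auto simp: X_def)
    finally have "card (g ` {p \<in> S. r p = i \<and> c (\<sigma> p) = j}) = T i j"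
      by (simp add: card_cartesian_product)
    moreover have "inj_on g {p \<in> S. r p = i \<and> c (\<sigma> p) = j}"
      using bij_betw_imp_inj_on[OF g(1)] by (rule inj_on_subset) auto
    ultimately show ?thesis by (simp add: card_image)
  qed
  ultimately show ?thesis by blast
qed

section \<open>Blocks of partitions\<close>

text \<open>
  The block index serves as the row label (for \<open>\<lambda>\<close>) and as the column label (for \<open>\<mu>\<close>) of a
  number in \<open>{1..n}\<close>.
\<close>

definition block_index :: "nat list \<Rightarrow> nat \<Rightarrow> nat" where
  "block_index xs p = (THE i. i < length xs \<and> p \<in> block xs i)"

lemma block_index_eq:
  assumes "i < length xs" "p \<in> block xs i"
  shows "block_index xs p = i"
  unfolding block_index_def using assms block_unique by (intro the_equality) auto

lemma block_index:
  assumes "p \<in> {1..sum_list xs}"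
  shows "block_index xs p < length xs" "p \<in> block xs (block_index xs p)"
proof -
  obtain i where "i < length xs" "p \<in> block xs i" using block_cover assms by auto
  then show "block_index xs p < length xs" "p \<in> block xs (block_index xs p)"
    by (simp_all add: block_index_eq)
qed

lemma block_eq_block_index:
  assumes "i < length xs"
  shows "block xs i = {p \<in> {1..sum_list xs}. block_index xs p = i}"
  using assms block_index_eq block_index block_subset by blast

lemma card_block:
  assumes "i < length xs"
  shows "card (block xs i) = xs ! i"
  using assms by (simp add: block_def take_Suc_conv_app_nth)

lemma card_same_block_index:
  assumes "p \<in> {1..sum_list xs}"
  shows "card {q \<in> {1..sum_list xs}. block_index xs q = block_index xs p} = xs ! block_index xs p"
  using card_block[OF block_index(1)[OF assms]]
  unfolding block_eq_block_index[OF block_index(1)[OF assms]] .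

lemma less_of_block_index_less:
  assumes "p \<in> {1..sum_list xs}" "q \<in> {1..sum_list xs}" "block_index xs p < block_index xs q"
  shows "p < q"
  using block_index(2)[OF assms(1)] block_index(2)[OF assms(2)]
    sum_list_take_mono[of "Suc (block_index xs p)" "block_index xs q" xs] assms(3)
  by (auto simp: block_def)

lemma block_sizes_antimono:
  assumes "is_partition n xs" "p \<in> {1..n}" "q \<in> {1..n}" "block_index xs p \<le> block_index xs q"
  shows "xs ! block_index xs q \<le> xs ! block_index xs p"
proof (cases "block_index xs p = block_index xs q")
  case False
  then show ?thesis
    using assms block_index(1)[of q xs] sorted_wrt_nth_less[of "(\<ge>)" xs]
    by (auto simp: is_partition_def)
qed simp

text \<open>
  The parts are weakly decreasing, so a strictly larger block lies strictly to the left. If \<open>a\<close> is in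
  the row of \<open>p\<close> and in a larger column, it lies left of the column of \<open>p\<close>, which contains \<open>b\<close>, so
  \<open>a < b\<close>. If \<open>b\<close> is in a larger row, then symmetrically \<open>b < a\<close>.
\<close>

lemma noncrossing_blocks:
  assumes lam: "is_partition n lam" and mu: "is_partition n mu"
  shows "noncrossing_table_coset {1..n} (block_index lam) (block_index mu)"
proof -
  interpret table_coset "{1..n}" "block_index lam" "block_index mu"
    by unfold_locales simp
  have sl: "sum_list lam = n" and sm: "sum_list mu = n"
    using lam mu by (auto simp: is_partition_def)
  have rs: "row_size p = lam ! block_index lam p" if "p \<in> {1..n}" for p
    using card_same_block_index[of p lam] that unfolding sl row_size_def .
  have cs: "col_size p = mu ! block_index mu p" if "p \<in> {1..n}" for p
    using card_same_block_index[of p mu] that unfolding sm col_size_def .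
  show ?thesis
  proof
    fix p a b
    assume S: "p \<in> {1..n}" "a \<in> {1..n}" "b \<in> {1..n}"
      and ra: "block_index lam a = block_index lam p" and cb: "block_index mu b = block_index mu p"
    show "row_size b \<le> row_size p \<or> col_size a \<le> col_size p"
    proof (rule ccontr)
      assume "\<not> ?thesis"
      then have "\<not> row_size b \<le> row_size p" "\<not> col_size a \<le> col_size p" by blast+
      then have "block_index lam b < block_index lam a" "block_index mu a < block_index mu b"
        unfolding rs[OF S(1)] rs[OF S(3)] cs[OF S(1)] cs[OF S(2)]
        using block_sizes_antimono[OF lam S(1,3)] block_sizes_antimono[OF mu S(1,2)] ra cb
        by (metis not_le)+
      then have "b < a" "a < b"
        using less_of_block_index_less[of b lam a] less_of_block_index_less[of a mu b] S sl sm
        by auto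
      then show False by simp
    qed
  qed
qed

text \<open>
  This replaces counting inside blocks by counting labels on all of \<open>{1..n}\<close>, which is how the
  coset of the locale is described.
\<close>

lemma table_of_eq_card_block_index:
  assumes "is_partition n lam" "is_partition n mu" and \<sigma>: "\<sigma> permutes {1..n}"
    and ij: "i < length lam" "j < length mu"
  shows "table_of lam mu \<sigma> i j =
    card {p \<in> {1..n}. block_index lam p = i \<and> block_index mu (\<sigma> p) = j}"
proof -
  have "sum_list lam = n" "sum_list mu = n"
    using assms(1,2) by (auto simp: is_partition_def)
  then have "{p \<in> block lam i. \<sigma> p \<in> block mu j} =
      {p \<in> {1..n}. block_index lam p = i \<and> block_index mu (\<sigma> p) = j}"
    using permutes_in_image[OF \<sigma>] block_eq_block_index[OF ij(1)] block_eq_block_index[OF ij(2)]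
    by auto
  then show ?thesis by (simp add: table_of_def)
qed

lemma double_coset_of_table_nonempty:
  assumes lam: "is_partition n lam" and mu: "is_partition n mu"
    and T: "contingency_table lam mu T"
  shows "double_coset_of_table n lam mu T \<noteq> {}"
proof -
  have sl: "sum_list lam = n" and sm: "sum_list mu = n"
    using lam mu by (auto simp: is_partition_def)
  have "\<exists>\<sigma>. \<sigma> permutes {1..n} \<and> (\<forall>i<length lam. \<forall>j<length mu.
      card {p \<in> {1..n}. block_index lam p = i \<and> block_index mu (\<sigma> p) = j} = T i j)"
  proof (rule exists_permutation_with_table)
    show "block_index lam p < length lam" "block_index mu p < length mu" if "p \<in> {1..n}" for p
      using block_index(1)[of p lam] block_index(1)[of p mu] that sl sm by auto
    show "(\<Sum>j<length mu. T i j) = card {p \<in> {1..n}. block_index lam p = i}"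
      if "i < length lam" for i
      using T that block_eq_block_index[OF that] card_block[OF that]
      by (simp add: sl contingency_table_def)
    show "(\<Sum>i<length lam. T i j) = card {p \<in> {1..n}. block_index mu p = j}"
      if "j < length mu" for j
      using T that block_eq_block_index[OF that] card_block[OF that]
      by (simp add: sm contingency_table_def)
  qed simp
  then obtain \<sigma> where \<sigma>: "\<sigma> permutes {1..n}" "\<And>i j. i < length lam \<Longrightarrow> j < length mu \<Longrightarrow>
      card {p \<in> {1..n}. block_index lam p = i \<and> block_index mu (\<sigma> p) = j} = T i j"
    by blast
  have "table_of lam mu \<sigma> i j = T i j" if "i < length lam" "j < length mu" for i j
    using \<sigma>(2)[OF that] by (simp only: table_of_eq_card_block_index[OF lam mu \<sigma>(1) that])
  then show ?thesis using \<sigma>(1) by (auto simp: double_coset_of_table_def)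
qed

text \<open>
  The locale constrains all pairs of labels, so the table is extended by zero outside the actual
  rows and columns.
\<close>

lemma double_coset_of_table_eq_coset:
  assumes lam: "is_partition n lam" and mu: "is_partition n mu"
  shows "double_coset_of_table n lam mu T = table_coset.coset {1..n} (block_index lam)
    (block_index mu) (\<lambda>i j. if i < length lam \<and> j < length mu then T i j else 0)"
    (is "_ = table_coset.coset _ _ _ ?T")
proof -
  interpret table_coset "{1..n}" "block_index lam" "block_index mu" ?T
    by unfold_locales simp
  have sl: "sum_list lam = n" and sm: "sum_list mu = n"
    using lam mu by (auto simp: is_partition_def)
  have "(\<forall>i<length lam. \<forall>j<length mu. table_of lam mu \<sigma> i j = T i j) \<longleftrightarrow>
      (\<forall>i j. card {x \<in> {1..n}. block_index lam x = i \<and> block_index mu (\<sigma> x) = j} = ?T i j)"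
    if \<sigma>: "\<sigma> permutes {1..n}" for \<sigma>
  proof -
    have in_n: "\<sigma> x \<in> {1..n} \<longleftrightarrow> x \<in> {1..n}" for x using permutes_in_image[OF \<sigma>] .
    have "card {x \<in> {1..n}. block_index lam x = i \<and> block_index mu (\<sigma> x) = j} =
        (if i < length lam \<and> j < length mu then table_of lam mu \<sigma> i j else 0)" for i j
    proof (cases "i < length lam \<and> j < length mu")
      case True
      then show ?thesis using table_of_eq_card_block_index[OF lam mu \<sigma>] by simp
    next
      case False
      have "block_index lam x < length lam" "block_index mu (\<sigma> x) < length mu" if "x \<in> {1..n}" for x
        using that in_n block_index(1)[of x lam] block_index(1)[of "\<sigma> x" mu] by (auto simp: sl sm)
      then have "{x \<in> {1..n}. block_index lam x = i \<and> block_index mu (\<sigma> x) = j} = {}"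
        using False by blast
      then show ?thesis using False by (simp only: card.empty if_False)
    qed
    then show ?thesis by auto
  qed
  then show ?thesis unfolding double_coset_of_table_def coset_def by blast
qed

text \<open>
  When the standard deviation or the mean vanishes, the normalised number of fixed points is zero on
  the whole double coset (in the first case because division by zero gives zero), and both events
  have probability zero.
\<close>

theorem proposition7p1:
  fixes n :: nat and lam mu :: "nat list" and T :: "nat \<Rightarrow> nat \<Rightarrow> nat"
    and P :: "(nat \<Rightarrow> nat) pmf" and W :: "(nat \<Rightarrow> nat) \<Rightarrow> real" and mean sd :: real
  assumes "is_partition n lam" and "is_partition n mu"
    and "contingency_table lam mu T"
    and "P = pmf_of_set (double_coset_of_table n lam mu T)"
    and "W = (\<lambda>\<sigma>. real (fp n \<sigma>))"
    and "mean = measure_pmf.expectation P W"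
    and "sd = sqrt (measure_pmf.variance P W)"
  shows "\<forall>t>0.
      measure_pmf.prob P {\<sigma>. (W \<sigma> - mean) / sd \<le> - t}
        \<le> exp (- (sd\<^sup>2 * t\<^sup>2 / (4 * mean))) \<and>
      measure_pmf.prob P {\<sigma>. (W \<sigma> - mean) / sd \<ge> t}
        \<le> exp (- (sd\<^sup>2 * t\<^sup>2 / (4 * mean + 2 * sd * t)))"
proof (intro allI impI)
  \<comment> \<open>Otherwise \<open>{1..n}\<close> inside the constants of the locale turns into \<open>{Suc 0..n}\<close>, and their
      facts no longer match.\<close>
  note One_nat_def [simp del]
  fix t :: real assume t: "t > 0"
  let ?G = "double_coset_of_table n lam mu T"
  interpret noncrossing_table_coset "{1..n}" "block_index lam" "block_index mu"
    "\<lambda>i j. if i < length lam \<and> j < length mu then T i j else 0"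
    by (rule noncrossing_blocks[OF assms(1,2)])
  have G: "?G = coset" by (rule double_coset_of_table_eq_coset[OF assms(1,2)])
  have G0: "?G \<noteq> {}" by (rule double_coset_of_table_nonempty[OF assms(1-3)])
  have finG: "finite ?G" using finite_coset by (simp add: G)
  have cardG: "card ?G > 0" using G0 finG by (simp add: card_gt_0_iff)
  have W: "W \<sigma> = real (fixes_of \<sigma>)" for \<sigma>
    by (simp only: assms(5) fp_def fixes_of_def)
  have total: "(\<Sum>\<sigma>\<in>?G. real (fixes_of \<sigma>)) = real (card ?G) * mean_fixes"
    unfolding G by (rule sum_fixes_of)
  have mean: "mean = mean_fixes"
    using total cardG
    by (simp add: assms(4,6) integral_pmf_of_set[OF G0 finG] W)
  have prob: "measure_pmf.prob P A = real (card {\<sigma> \<in> ?G. \<sigma> \<in> A}) / real (card ?G)" for A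
    by (simp add: assms(4) measure_pmf_of_set[OF G0 finG] Int_def)
  have sd0: "sd \<ge> 0"
    by (simp add: assms(7))
  show "measure_pmf.prob P {\<sigma>. (W \<sigma> - mean) / sd \<le> - t}
        \<le> exp (- (sd\<^sup>2 * t\<^sup>2 / (4 * mean))) \<and>
      measure_pmf.prob P {\<sigma>. (W \<sigma> - mean) / sd \<ge> t}
        \<le> exp (- (sd\<^sup>2 * t\<^sup>2 / (4 * mean + 2 * sd * t)))"
  proof (cases "sd = 0 \<or> mean = 0")
    case True
    have zero: "(W \<sigma> - mean) / sd = 0" if "\<sigma> \<in> ?G" for \<sigma>
    proof (cases "sd = 0")
      case False
      then have m0: "mean = 0" using True by simp
      then have "(\<Sum>\<sigma>\<in>?G. real (fixes_of \<sigma>)) = 0"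
        using total mean by simp
      then have "W \<sigma> = 0"
        using that finG by (simp add: sum_nonneg_eq_0_iff W)
      then show ?thesis by (simp add: m0)
    qed simp
    have "{\<sigma> \<in> ?G. (W \<sigma> - mean) / sd \<le> - t} = {}" "{\<sigma> \<in> ?G. t \<le> (W \<sigma> - mean) / sd} = {}"
      using zero t by fastforce+
    then show ?thesis by (simp add: prob del: Collect_empty_eq)
  next
    case False
    have "mean \<ge> 0"
      by (simp add: mean mean_fixes_def sum_nonneg weight_nonneg)
    then have M: "mean > 0" and sd: "sd > 0" using False sd0 by auto
    then have x: "sd * t > 0" using t by simp
    have "(W \<sigma> - mean) / sd \<le> - t \<longleftrightarrow> real (fixes_of \<sigma>) \<le> mean_fixes - sd * t"
      "t \<le> (W \<sigma> - mean) / sd \<longleftrightarrow> mean_fixes + sd * t \<le> real (fixes_of \<sigma>)" for \<sigma>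
      using sd by (auto simp: W mean field_simps)
    then show ?thesis
      using lower_tail[of "sd * t"] upper_tail[of "sd * t"] M x cardG
      by (simp add: prob mean G pos_divide_le_eq power_mult_distrib mult_ac)
  qed
qed

end
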